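(* Let $k \in \mathbb{N}$ with $k\ge 2$, let $\xi>0$, and let $G$ be a $\xi$-expanding $k$-graph on $n$ vertices. Then \[ c(G) \leq 20\, \xi^{-2} \sqrt{\frac{n}{k}}\, \log n . \]
   Context: A $k$-graph is a $k$-uniform hypergraph. Cops and Robber on a hypergraph $H$: one player places $m$ cops on vertices, then the other player places a single robber on a vertex; then the players alternate turns (cops first), and in a turn a player may move each of their pieces to a vertex sharing an edge with its current vertex, or leave it in place (several cops may share a vertex). Both players have full information. The cops win if at some point a cop occupies the robber's vertex. The cop number $c(H)$ is the minimum $m$ such that $m$ cops have a winning strategy. Distance: for distinct vertices $x,y$, $\mathrm{dist}(x,y)$ is the smallest $t$ such that there are edges $e_1,\dots,e_t$ with $x\in e_1$, $y\in e_t$ and $e_i\cap e_{i+1}\neq\emptyset$ for all $i$; $\mathrm{dist}(x,x)=0$. For vertex sets $A,A'$, $\mathrm{dist}(A,A')=\min_{u\in A,v\in A'}\mathrm{dist}(u,v)$ (an edge is regarded as its vertex set). For $A\subseteq V(G)$ and $r\in\mathbb{N}_0$, $N_V^r(A)=\{v:\mathrm{dist}(A,v)\le r\}$; for $r\in\mathbb{N}$, $N_E^r(A)=\{e\in E(G):\mathrm{dist}(e,A)\le r-1\}$. For $B\subseteq E(G)$, $V_B=\bigcup_{e\in B}e$ and $N_V^r(B)=N_V^r(V_B)$. The average vertex degree is $d(G)=\frac1{|V(G)|}\sum_{v}|N_V^1(v)|$. $\xi$-expanding: Let $G$ be a $k$-graph on $n$ vertices with average vertex degree $d\ge k$ and let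 $0<\xi\le 1$. $G$ is $\xi$-expanding if: (A.1) for every vertex $v$ and $r\in\mathbb{N}$ with $d^r\le\sqrt{nk}$, $|N_E^r(v)|\le \frac1\xi\frac{d^r}{k}$; (A.2) for every $A\subseteq V(G)$ and $r\in\mathbb{N}$, $\xi\min\{|A|d^r,n\}\le |N_V^r(A)|\le \frac1\xi|A|d^r$; (A.3) for every $B\subseteq E(G)$ and $r\in\mathbb{N}$, $\xi\min\{|B|kd^r,n\}\le|N_V^r(B)|$. *)

theory Defs
  imports Complex_Main "HOL-Library.Extended_Nat"
begin

text \<open>A hypergraph is given by its vertex set \<open>V\<close> and its edge set \<open>E\<close>.\<close>

definition k_graph :: "nat \<Rightarrow> 'a set \<Rightarrow> 'a set set \<Rightarrow> bool" where
  "k_graph k V E \<longleftrightarrow> finite V \<and> (\<forall>e\<in>E. e \<subseteq> V \<and> card e = k)"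

subsection \<open>Distances and neighbourhoods\<close>

definition edge_chain :: "'a set set \<Rightarrow> 'a \<Rightarrow> 'a \<Rightarrow> 'a set list \<Rightarrow> bool" where
  "edge_chain E x y es \<longleftrightarrow>
     es \<noteq> [] \<and> set es \<subseteq> E \<and> x \<in> hd es \<and> y \<in> last es \<and>
     (\<forall>i. Suc i < length es \<longrightarrow> es ! i \<inter> es ! Suc i \<noteq> {})"

text \<open>The infimum of the empty set of extended naturals is \<open>\<infinity>\<close>; so vertices that are not
  connected, and pairs of sets one of which is empty, have distance \<open>\<infinity>\<close>.\<close>

definition vdist :: "'a set set \<Rightarrow> 'a \<Rightarrow> 'a \<Rightarrow> enat" where
  "vdist E x y =
     (if x = y then 0 else Inf {enat (length es) | es. edge_chain E x y es})"

definition sdist :: "'a set set \<Rightarrow> 'a set \<Rightarrow> 'a set \<Rightarrow> enat" where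
  "sdist E A A' = (INF u\<in>A. INF v\<in>A'. vdist E u v)"

definition NV :: "'a set \<Rightarrow> 'a set set \<Rightarrow> nat \<Rightarrow> 'a set \<Rightarrow> 'a set" where
  "NV V E r A = {v \<in> V. sdist E A {v} \<le> enat r}"

text \<open>Only meaningful for \<open>r \<ge> 1\<close>.\<close>

definition NE :: "'a set set \<Rightarrow> nat \<Rightarrow> 'a set \<Rightarrow> 'a set set" where
  "NE E r A = {e \<in> E. sdist E e A \<le> enat (r - 1)}"

text \<open>A vertex counts towards its own degree.\<close>

definition avg_degree :: "'a set \<Rightarrow> 'a set set \<Rightarrow> real" where
  "avg_degree V E = (\<Sum>v\<in>V. real (card (NV V E 1 {v}))) / real (card V)"

definition expanding :: "nat \<Rightarrow> real \<Rightarrow> 'a set \<Rightarrow> 'a set set \<Rightarrow> bool" where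
  "expanding k \<xi> V E \<longleftrightarrow>
     (let n = real (card V); d = avg_degree V E in
        d \<ge> real k \<and> 0 < \<xi> \<and> \<xi> \<le> 1 \<and>
        (\<forall>v\<in>V. \<forall>r\<ge>1. d ^ r \<le> sqrt (n * real k) \<longrightarrow>
           real (card (NE E r {v})) \<le> (1 / \<xi>) * (d ^ r / real k)) \<and>
        (\<forall>A. A \<subseteq> V \<longrightarrow> (\<forall>r\<ge>1.
           \<xi> * min (real (card A) * d ^ r) n \<le> real (card (NV V E r A)) \<and>
           real (card (NV V E r A)) \<le> (1 / \<xi>) * (real (card A) * d ^ r))) \<and>
        (\<forall>B. B \<subseteq> E \<longrightarrow> (\<forall>r\<ge>1.
           \<xi> * min (real (card B) * real k * d ^ r) n \<le> real (card (NV V E r (\<Union>B))))))"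

subsection \<open>Cops and Robber\<close>

definition move :: "'a set set \<Rightarrow> 'a \<Rightarrow> 'a \<Rightarrow> bool" where
  "move E u v \<longleftrightarrow> u = v \<or> (\<exists>e\<in>E. u \<in> e \<and> v \<in> e)"

text \<open>\<open>r 0\<close> is the robber's initial vertex and \<open>r t\<close> his vertex after his \<open>t\<close>-th turn.\<close>

definition robber_play :: "'a set \<Rightarrow> 'a set set \<Rightarrow> (nat \<Rightarrow> 'a) \<Rightarrow> bool" where
  "robber_play V E r \<longleftrightarrow> r 0 \<in> V \<and> (\<forall>t. move E (r t) (r (Suc t)))"

text \<open>A strategy \<open>S\<close> for cops \<open>0, \<dots>, m - 1\<close> maps what the robber has done so far to the
  positions of the cops: \<open>S []\<close> is the initial placement and \<open>S [r 0, \<dots>, r t]\<close> is the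
  placement after the cops' turn number \<open>t + 1\<close>.  The cops' own past moves are determined by
  \<open>S\<close> and the robber's past moves, so they need not be an argument.\<close>

definition cop_pos :: "('a list \<Rightarrow> nat \<Rightarrow> 'a) \<Rightarrow> (nat \<Rightarrow> 'a) \<Rightarrow> nat \<Rightarrow> nat \<Rightarrow> 'a" where
  "cop_pos S r t = S (map r [0..<t])"

definition cop_strategy ::
  "'a set \<Rightarrow> 'a set set \<Rightarrow> nat \<Rightarrow> ('a list \<Rightarrow> nat \<Rightarrow> 'a) \<Rightarrow> bool" where
  "cop_strategy V E m S \<longleftrightarrow>
     (\<forall>i<m. S [] i \<in> V) \<and>
     (\<forall>r. robber_play V E r \<longrightarrow>
        (\<forall>t. \<forall>i<m. move E (cop_pos S r t i) (cop_pos S r (Suc t) i)))"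

text \<open>The order of play is \<open>cop_pos S r 0\<close>, \<open>r 0\<close>, \<open>cop_pos S r 1\<close>, \<open>r 1\<close>, \<dots>; the robber
  can be caught after his own placement or move and after a move of the cops.  How play
  continues after a capture is irrelevant.\<close>

definition winning ::
  "'a set \<Rightarrow> 'a set set \<Rightarrow> nat \<Rightarrow> ('a list \<Rightarrow> nat \<Rightarrow> 'a) \<Rightarrow> bool" where
  "winning V E m S \<longleftrightarrow>
     cop_strategy V E m S \<and>
     (\<forall>r. robber_play V E r \<longrightarrow>
        (\<exists>t. \<exists>i<m. cop_pos S r t i = r t \<or> cop_pos S r (Suc t) i = r t))"

definition cops_win :: "'a set \<Rightarrow> 'a set set \<Rightarrow> nat \<Rightarrow> bool" where
  "cops_win V E m \<longleftrightarrow> (\<exists>S. winning V E m S)"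

definition cop_number :: "'a set \<Rightarrow> 'a set set \<Rightarrow> nat" where
  "cop_number V E = (LEAST m. cops_win V E m)"

text \<open>The minimum exists for every finite vertex set: put a cop on each vertex.\<close>

lemma cops_win_card:
  assumes "finite V"
  shows "cops_win V E (card V)"
proof -
  obtain f where f: "bij_betw f {0..<card V} V"
    using ex_bij_betw_nat_finite[OF assms] by blast
  have "winning V E (card V) (\<lambda>h. f)"
    unfolding winning_def cop_strategy_def
  proof (intro conjI allI impI)
    fix i assume "i < card V"
    then show "f i \<in> V" using f by (auto simp: bij_betw_def)
  next
    fix r assume "robber_play V E r"
    then have "r 0 \<in> f ` {0..<card V}"
      using f by (auto simp: bij_betw_def robber_play_def)
    then show "\<exists>t. \<exists>i<card V. cop_pos (\<lambda>h. f) r t i = r t \<or> cop_pos (\<lambda>h. f) r (Suc t) i = r t"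
      unfolding cop_pos_def by (metis atLeastLessThan_iff imageE)
  qed (simp add: move_def cop_pos_def)
  then show ?thesis unfolding cops_win_def by blast
qed

lemma cops_win_cop_number: "finite V \<Longrightarrow> cops_win V E (cop_number V E)"
  unfolding cop_number_def by (rule LeastI, rule cops_win_card)

end

theory Submission
  imports Defs "HOL-Library.FuncSet"
begin

text \<open>
  Let \<open>d ^ r \<le> sqrt (n * k) < d ^ (r + 1)\<close>, and let \<open>v\<close> be the robber's initial vertex.
  If \<open>d ^ r \<le> sqrt (n / k)\<close>, the cops try to occupy every vertex of the ball of radius \<open>r\<close>
  around \<open>v\<close> within \<open>r + 1\<close> turns, before the robber can leave it; otherwise they try to occupy
  every edge of \<open>NE E r {v}\<close> within \<open>r\<close> turns, so that the robber's \<open>r\<close>-th move is along an edge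
  containing a cop. In both cases there are at most \<open>sqrt (n / k) / \<xi>\<close> targets. Put the cops
  on independent uniformly random vertices. By expansion and a Chernoff-type estimate, with positive
  probability every set \<open>B\<close> of targets has, for each \<open>v\<close>, at least \<open>card B\<close> cops close enough,
  and Hall's theorem assigns distinct cops to the targets.
\<close>

section \<open>Hall's marriage theorem\<close>

text \<open>Induction on \<open>I\<close>. If some nonempty proper subset \<open>J\<close> is tight,
  \<open>J\<close> and its complement are matched separately, the complement avoiding every element
  available to \<open>J\<close>. Otherwise any \<open>i\<close> may take any element of
  \<open>A i\<close>, since every other nonempty subfamily has an element to spare.\<close>

lemma hall:
  fixes A :: "'i \<Rightarrow> 'b set"
  assumes "finite I" and "\<And>i. i \<in> I \<Longrightarrow> finite (A i)"
    and "\<And>J. J \<subseteq> I \<Longrightarrow> card J \<le> card (\<Union>(A ` J))"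
  shows "\<exists>g. inj_on g I \<and> (\<forall>i\<in>I. g i \<in> A i)"
  using assms
proof (induction I arbitrary: A rule: finite_psubset_induct)
  case (psubset I)
  note fin = psubset.prems(1) and cond = psubset.prems(2)
  have finU: "finite (\<Union>(A ` J))" if "J \<subseteq> I" for J
    using that fin finite_subset[OF that psubset.hyps(1)] by auto
  show ?case
  proof (cases "I = {}")
    case False
    show ?thesis
    proof (cases "\<exists>J. J \<subset> I \<and> J \<noteq> {} \<and> card J = card (\<Union>(A ` J))")
      case True
      then obtain J where J: "J \<subset> I" "J \<noteq> {}" "card J = card (\<Union>(A ` J))" by blast
      define U where "U = \<Union>(A ` J)"
      have "\<exists>g. inj_on g J \<and> (\<forall>i\<in>J. g i \<in> A i)"
        by (rule psubset.IH) (use J fin cond in auto)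
      then obtain g1 where g1: "inj_on g1 J" "\<forall>i\<in>J. g1 i \<in> A i" by blast
      have "\<exists>g. inj_on g (I - J) \<and> (\<forall>i\<in>I - J. g i \<in> A i - U)"
      proof (rule psubset.IH)
        show "I - J \<subset> I" using J by blast
        show "finite (A i - U)" if "i \<in> I - J" for i using that fin by blast
        show "card K \<le> card (\<Union>i\<in>K. A i - U)" if K: "K \<subseteq> I - J" for K
        proof -
          have fK: "finite K" "finite J"
            using K J psubset.hyps(1) by (meson Diff_subset finite_subset psubset_imp_subset)+
          have KJ: "K \<union> J \<subseteq> I" using K J by blast
          \<comment> \<open>Hall's condition for \<open>K\<close> after removal of \<open>U\<close>
            is the condition for \<open>K \<union> J\<close> minus the equality for the tight set
            \<open>J\<close>.\<close>
          have "card K + card J = card (K \<union> J)"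
            by (subst card_Un_disjoint) (use K fK in auto)
          also have "\<dots> \<le> card (\<Union>(A ` (K \<union> J)))" using cond[OF KJ] .
          also have "\<Union>(A ` (K \<union> J)) = U \<union> (\<Union>i\<in>K. A i - U)" unfolding U_def by auto
          also have "card \<dots> \<le> card U + card (\<Union>i\<in>K. A i - U)" by (rule card_Un_le)
          finally show ?thesis using J(3) unfolding U_def by simp
        qed
      qed
      then obtain g2 where g2: "inj_on g2 (I - J)" "\<forall>i\<in>I - J. g2 i \<in> A i - U" by blast
      let ?g = "\<lambda>i. if i \<in> J then g1 i else g2 i"
      have "inj_on ?g I"
        using g1 g2 unfolding inj_on_def U_def by (metis DiffD2 DiffI UN_I)
      moreover have "\<forall>i\<in>I. ?g i \<in> A i" using g1 g2 by auto
      ultimately show ?thesis by blast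
    next
      case noJ: False
      obtain i where i: "i \<in> I" using False by blast
      have "card {i} \<le> card (\<Union>(A ` {i}))" by (rule cond) (use i in auto)
      then obtain x where x: "x \<in> A i" by fastforce
      have "\<exists>g. inj_on g (I - {i}) \<and> (\<forall>j\<in>I - {i}. g j \<in> A j - {x})"
      proof (rule psubset.IH)
        show "I - {i} \<subset> I" using i by blast
        show "finite (A j - {x})" if "j \<in> I - {i}" for j using that fin by blast
        show "card K \<le> card (\<Union>j\<in>K. A j - {x})" if K: "K \<subseteq> I - {i}" for K
        proof (cases "K = {}")
          case K0: False
          \<comment> \<open>\<open>K\<close> omits \<open>i\<close>, so it is a proper subset and
            not tight; removing \<open>x\<close> costs at most the one spare element.\<close>
          have "K \<subset> I" using K i by blast
          then have "card K < card (\<Union>(A ` K))"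
            using noJ K0 cond[of K] by (metis le_neq_implies_less psubset_imp_subset)
          moreover have "(\<Union>j\<in>K. A j - {x}) = \<Union>(A ` K) - {x}" by auto
          ultimately show ?thesis
            using card_Diff1_le[of "\<Union>(A ` K)" x]
            by (metis card_Diff_singleton_if less_Suc_eq_le Suc_pred' diff_0_eq_0 less_imp_le
                le_eq_less_or_eq less_Suc_eq not_gr_zero)
        qed simp
      qed
      then obtain g where g: "inj_on g (I - {i})" "\<forall>j\<in>I - {i}. g j \<in> A j - {x}" by blast
      have "inj_on (g(i := x)) I" using g unfolding inj_on_def by auto
      moreover have "\<forall>j\<in>I. (g(i := x)) j \<in> A j" using g x by auto
      ultimately show ?thesis by blast
    qed
  qed simp
qed

section \<open>Distances and walks\<close>

lemma move_sym: "move E u v \<Longrightarrow> move E v u"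
  unfolding move_def by auto

lemma move_refl: "move E u u"
  unfolding move_def by simp

lemma relpowp_move_sym: "(move E ^^ r) u v \<Longrightarrow> (move E ^^ r) v u"
proof (induction r arbitrary: v)
  case (Suc r)
  then obtain w where "(move E ^^ r) u w" "move E w v" by auto
  then show ?case using Suc.IH move_sym by (metis relpowp_Suc_I2)
qed auto

lemma edge_chain_Cons:
  assumes "es \<noteq> []"
  shows "edge_chain E x y (e # es) \<longleftrightarrow> e \<in> E \<and> x \<in> e \<and> (\<exists>z\<in>e. edge_chain E z y es)"
proof -
  have all_nat: "(\<forall>i. Q i) \<longleftrightarrow> Q 0 \<and> (\<forall>i. Q (Suc i))" for Q :: "nat \<Rightarrow> bool"
    by (metis not0_implies_Suc)
  have "(\<forall>i. Suc i < length (e # es) \<longrightarrow> (e # es) ! i \<inter> (e # es) ! Suc i \<noteq> {}) \<longleftrightarrow>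
    e \<inter> hd es \<noteq> {} \<and> (\<forall>i. Suc i < length es \<longrightarrow> es ! i \<inter> es ! Suc i \<noteq> {})"
    using assms by (subst all_nat) (auto simp: hd_conv_nth)
  then show ?thesis using assms unfolding edge_chain_def by auto
qed

lemma edge_chain_walk: "edge_chain E x y es \<Longrightarrow> (move E ^^ length es) x y"
proof (induction es arbitrary: x)
  case Nil
  then show ?case by (simp add: edge_chain_def)
next
  case (Cons e es)
  show ?case
  proof (cases "es = []")
    case True
    then show ?thesis using Cons.prems by (auto simp: edge_chain_def move_def)
  next
    case False
    then obtain z where z: "e \<in> E" "x \<in> e" "z \<in> e" "edge_chain E z y es"
      using Cons.prems edge_chain_Cons[OF False] by blast
    then have "move E x z" by (auto simp: move_def)
    then show ?thesis using Cons.IH[OF z(4)] by (metis length_Cons relpowp_Suc_I2)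
  qed
qed

text \<open>Moves that stay in place contribute no edge, so the chain may be shorter than the
  walk.\<close>

lemma walk_edge_chain:
  "(move E ^^ r) x y \<Longrightarrow> x = y \<or> (\<exists>es. edge_chain E x y es \<and> length es \<le> r)"
proof (induction r arbitrary: x)
  case (Suc r)
  obtain z where z: "move E x z" "(move E ^^ r) z y"
    using Suc.prems by (meson relpowp_Suc_D2)
  show ?case
  proof (cases "x = z")
    case True
    then show ?thesis using Suc.IH[OF z(2)] by (auto intro: le_SucI)
  next
    case False
    then obtain e where e: "e \<in> E" "x \<in> e" "z \<in> e" using z by (auto simp: move_def)
    from Suc.IH[OF z(2)] show ?thesis
    proof
      assume "z = y"
      then have "edge_chain E x y [e]" using e by (auto simp: edge_chain_def)
      then show ?thesis by (intro disjI2 exI[of _ "[e]"]) auto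
    next
      assume "\<exists>es. edge_chain E z y es \<and> length es \<le> r"
      then obtain es where es: "edge_chain E z y es" "length es \<le> r" by blast
      then have "es \<noteq> []" by (simp add: edge_chain_def)
      then have "edge_chain E x y (e # es)" using edge_chain_Cons e es by metis
      then show ?thesis using es(2) by (intro disjI2 exI[of _ "e # es"]) auto
    qed
  qed
qed auto

lemma relpowp_move_mono:
  assumes "(move E ^^ r) x y" "r \<le> s"
  shows "(move E ^^ s) x y"
  using assms(2)
proof (induction s rule: dec_induct)
  case base
  then show ?case using assms by simp
next
  case (step s)
  then show ?case using move_refl by (metis relpowp_Suc_I)
qed

text \<open>A bound by \<open>enat r\<close> is a strict bound by \<open>enat (Suc r)\<close>, and a
  strict bound on an infimum is witnessed by a member. Empty \<open>A\<close> is included, its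
  infimum being infinite.\<close>

lemma INF_enat_le_iff:
  fixes f :: "'a \<Rightarrow> enat"
  shows "(INF x\<in>A. f x) \<le> enat r \<longleftrightarrow> (\<exists>x\<in>A. f x \<le> enat r)"
proof -
  have le: "x \<le> enat r \<longleftrightarrow> x < enat (Suc r)" for x
    by (cases x) auto
  show ?thesis unfolding le INF_less_iff ..
qed

text \<open>Turns distances into moves of the game. Since a piece may rest, reachability in exactly
  \<open>r\<close> moves and in at most \<open>r\<close> moves coincide.\<close>

lemma vdist_le_iff: "vdist E x y \<le> enat r \<longleftrightarrow> (move E ^^ r) x y"
proof (cases "x = y")
  case True
  then show ?thesis
    using relpowp_move_mono[of 0 E x x r] by (simp add: vdist_def enat_0[symmetric])
next
  case False
  have "{enat (length es) |es. edge_chain E x y es} = (\<lambda>es. enat (length es)) ` {es. edge_chain E x y es}"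
    by auto
  then have "vdist E x y \<le> enat r \<longleftrightarrow> (\<exists>es. edge_chain E x y es \<and> length es \<le> r)"
    using False by (simp add: vdist_def INF_enat_le_iff)
  also have "\<dots> \<longleftrightarrow> (move E ^^ r) x y"
    using False walk_edge_chain edge_chain_walk relpowp_move_mono by metis
  finally show ?thesis .
qed

lemma NV_iff: "v \<in> NV V E r A \<longleftrightarrow> v \<in> V \<and> (\<exists>u\<in>A. (move E ^^ r) u v)"
  unfolding NV_def sdist_def INF_enat_le_iff vdist_le_iff by auto

lemma NE_iff: "e \<in> NE E r A \<longleftrightarrow> e \<in> E \<and> (\<exists>w\<in>e. \<exists>v\<in>A. (move E ^^ (r - 1)) w v)"
  unfolding NE_def sdist_def INF_enat_le_iff vdist_le_iff by auto

lemma robber_play_walk: "robber_play V E r \<Longrightarrow> (move E ^^ t) (r 0) (r t)"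
  by (induction t) (auto simp: robber_play_def)

lemma robber_play_in:
  assumes "robber_play V E r" "\<And>e. e \<in> E \<Longrightarrow> e \<subseteq> V"
  shows "r t \<in> V"
  using assms by (induction t) (auto simp: robber_play_def move_def, metis subsetD)

section \<open>Strategies\<close>

text \<open>Until the last step the cops react to the robber's initial vertex only. When the robber
  arrives at \<open>r T\<close>, cop \<open>i\<close> stands on \<open>P (r 0) i T\<close>; by
  \<open>near\<close> some cop can capture him in the cops' turn \<open>T + 1\<close>.\<close>

lemma cops_win_paths:
  assumes f: "\<And>i. i < m \<Longrightarrow> f i \<in> V"
    and P0: "\<And>v i. v \<in> V \<Longrightarrow> i < m \<Longrightarrow> P v i 0 = f i"
    and Pm: "\<And>v i t. v \<in> V \<Longrightarrow> i < m \<Longrightarrow> t < T \<Longrightarrow> move E (P v i t) (P v i (Suc t))"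
    and near: "\<And>r. robber_play V E r \<Longrightarrow> \<exists>i<m. move E (P (r 0) i T) (r T)"
  shows "cops_win V E m"
proof -
  \<comment> \<open>A cop follows its path for \<open>T\<close> turns and then steps onto the robber if it can.\<close>
  define S where "S h i = (if h = [] then f i
      else if length h \<le> T then P (hd h) i (length h)
      else if move E (P (hd h) i T) (h ! T) then h ! T else P (hd h) i T)" for h i
  have pos: "cop_pos S r t i = (if t \<le> T then P (r 0) i t
      else if move E (P (r 0) i T) (r T) then r T else P (r 0) i T)"
    if "robber_play V E r" "i < m" for r t i
  proof (cases t)
    case 0
    then show ?thesis using that P0 by (simp add: cop_pos_def S_def robber_play_def)
  next
    case (Suc t')
    then have "map r [0..<t] \<noteq> []" "hd (map r [0..<t]) = r 0"
      by (simp_all add: hd_map del: upt_Suc)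
    then show ?thesis by (simp add: cop_pos_def S_def)
  qed
  have "winning V E m S"
    unfolding winning_def cop_strategy_def
  proof (intro conjI allI impI)
    fix i assume "i < m"
    then show "S [] i \<in> V" using f by (simp add: S_def)
  next
    fix r t i assume r: "robber_play V E r" and i: "i < m"
    have "r 0 \<in> V" using r by (simp add: robber_play_def)
    \<comment> \<open>A move along the path, the final step, or rest: after turn
      \<open>T + 1\<close> the strategy still consults only \<open>h ! T\<close>, so positions no
      longer change.\<close>
    moreover have "t < T \<or> t = T \<or> T < t" by linarith
    ultimately show "move E (cop_pos S r t i) (cop_pos S r (Suc t) i)"
      using Pm[of "r 0" i t] i by (auto simp: pos[OF r i] move_refl)
  next
    fix r assume r: "robber_play V E r"
    then obtain i where i: "i < m" "move E (P (r 0) i T) (r T)" using near by blast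
    then have "cop_pos S r (Suc T) i = r T" using pos[OF r i(1)] by simp
    then show "\<exists>t. \<exists>i<m. cop_pos S r t i = r t \<or> cop_pos S r (Suc t) i = r t"
      using i by blast
  qed
  then show ?thesis unfolding cops_win_def by blast
qed

section \<open>Random placement of the cops\<close>

text \<open>The weight of a placement is a product over the cops of factors 1/2 or 1. This is
  independence in counting form: the sum over all placements factors into \<open>m\<close> equal
  sums over \<open>V\<close>.\<close>

lemma sum_half_power_hits:
  fixes V :: "'a set"
  assumes "finite V" "X \<subseteq> V"
  shows "(\<Sum>f\<in>PiE {..<m} (\<lambda>_. V). (1 / 2 :: real) ^ card {i. i < m \<and> f i \<in> X})
    = (real (card V) - real (card X) / 2) ^ m"
proof -
  have "(\<Sum>f\<in>PiE {..<m} (\<lambda>_. V). (1 / 2 :: real) ^ card {i. i < m \<and> f i \<in> X})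
    = (\<Sum>f\<in>PiE {..<m} (\<lambda>_. V). \<Prod>i<m. if f i \<in> X then 1 / 2 else 1)"
  proof (rule sum.cong[OF refl])
    fix f :: "nat \<Rightarrow> 'a"
    have "{..<m} \<inter> {i. f i \<in> X} = {i. i < m \<and> f i \<in> X}" by auto
    then show "(1 / 2 :: real) ^ card {i. i < m \<and> f i \<in> X} = (\<Prod>i<m. if f i \<in> X then 1 / 2 else 1)"
      by (simp add: prod.If_cases)
  qed
  also have "\<dots> = (\<Prod>i<m. \<Sum>v\<in>V. if v \<in> X then 1 / 2 else 1)"
    by (rule prod_sum_PiE[symmetric]) (use assms in auto)
  also have "(\<Sum>v\<in>V. if v \<in> X then 1 / 2 else 1) = (\<Sum>v\<in>V. 1 - (if v \<in> X then 1 / 2 else (0::real)))"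
    by (rule sum.cong) auto
  also have "\<dots> = real (card V) - real (card X) / 2"
  proof -
    have "V \<inter> X = X" using assms by blast
    then show ?thesis using assms by (simp add: sum_subtractf sum.If_cases)
  qed
  finally show ?thesis by simp
qed

text \<open>For a target set of size \<open>b\<close> whose neighbourhood has \<open>x\<close> vertices, the left-hand side
  is the sum over all placements of \<open>2 ^ (b - number of hits)\<close>, which bounds the number of
  placements with fewer than \<open>b\<close> hits.\<close>

lemma hits_weight_bound:
  fixes n x b m :: nat
  assumes "n \<ge> 2" "x \<le> n" "10 * real b * real n * ln (real n) \<le> real m * real x"
  shows "2 ^ b * (real n - real x / 2) ^ m \<le> real n ^ m * (1 / real n ^ 4) ^ b"
proof -
  have n: "real n \<ge> 2" using assms by simp
  have "real n - real x / 2 = real n * (1 + - (real x / (2 * real n)))"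
    using n by (simp add: field_simps)
  also have "\<dots> \<le> real n * exp (- (real x / (2 * real n)))"
    by (intro mult_left_mono exp_ge_add_one_self) simp
  finally have "(real n - real x / 2) ^ m \<le> (real n * exp (- (real x / (2 * real n)))) ^ m"
    by (rule power_mono) (use assms in simp)
  also have "\<dots> = real n ^ m * exp (- (real m * real x / (2 * real n)))"
    by (simp add: power_mult_distrib exp_of_nat_mult[symmetric])
  \<comment> \<open>The constant 10 of the hypothesis becomes 5 because hits are weighted by
    1/2.\<close>
  also have "\<dots> \<le> real n ^ m * exp (- (real b * (5 * ln (real n))))"
    using assms n by (intro mult_left_mono) (simp_all add: field_simps)
  also have "exp (- (real b * (5 * ln (real n)))) = (1 / real n ^ 5) ^ b"
  proof -
    have "exp (5 * ln (real n)) = real n ^ 5"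
      using n exp_of_nat_mult[of 5 "ln (real n)"] by simp
    then have "exp (real b * (5 * ln (real n))) = (real n ^ 5) ^ b"
      by (simp only: exp_of_nat_mult)
    then show ?thesis by (simp add: exp_minus power_divide inverse_eq_divide)
  qed
  finally have "2 ^ b * (real n - real x / 2) ^ m \<le> 2 ^ b * (real n ^ m * (1 / real n ^ 5) ^ b)"
    by simp
  also have "\<dots> = real n ^ m * (2 * (1 / real n ^ 5)) ^ b"
    by (simp add: power_mult_distrib power_divide)
  \<comment> \<open>One of the five factors \<open>n\<close> per target absorbs the factor
    2.\<close>
  also have "\<dots> \<le> real n ^ m * (1 / real n ^ 4) ^ b"
  proof (intro mult_left_mono power_mono)
    show "2 * (1 / real n ^ 5) \<le> 1 / real n ^ 4"
      using n by (simp add: field_simps eval_nat_numeral)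
  qed auto
  finally show ?thesis .
qed

text \<open>Over all subsets the sum is a product of at most \<open>n\<close> factors
  \<open>1 + 1 / n ^ 4\<close>, hence at most \<open>exp (1 / n ^ 3)\<close>; the empty set accounts
  for the 1. The bound \<open>1 / n\<close> leaves room for a union bound over \<open>n\<close>
  target families.\<close>

lemma sum_power_card_nonempty_subsets:
  fixes n :: nat
  assumes "n \<ge> 2" "finite S" "card S \<le> n"
  shows "(\<Sum>B\<in>Pow S - {{}}. (1 / real n ^ 4) ^ card B) < 1 / real n"
proof -
  let ?w = "1 / real n ^ 4" and ?y = "1 / real n ^ 3"
  have n: "real n \<ge> 2" using assms by simp
  have "(\<Sum>B\<in>Pow S. ?w ^ card B) = (\<Prod>x\<in>S. ?w + 1)"
    by (subst prod_add) (use assms in auto)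
  also have "\<dots> \<le> (1 + ?w) ^ n"
    using power_increasing[OF assms(3), of "1 + ?w"] by (simp add: add.commute)
  also have "\<dots> \<le> exp ?w ^ n" by (intro power_mono exp_ge_add_one_self) auto
  also have "\<dots> = exp ?y"
    using n by (simp add: exp_of_nat_mult[symmetric] eval_nat_numeral)
  also have "\<dots> \<le> 1 + ?y + ?y\<^sup>2"
    using n by (intro exp_bound) auto
  also have "\<dots> \<le> 1 + 2 * ?y"
  proof -
    have "?y * ?y \<le> ?y * 1" using n by (intro mult_left_mono) auto
    then show ?thesis by (simp add: power2_eq_square)
  qed
  also have "\<dots> < 1 + 1 / real n"
  proof -
    have "4 \<le> real n * real n" using mult_mono[of 2 "real n" 2 "real n"] n by simp
    then have "2 * real n < real n * real n * real n"
      using n by (intro mult_strict_right_mono) auto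
    then show ?thesis using n by (simp add: field_simps eval_nat_numeral)
  qed
  finally have "(\<Sum>B\<in>Pow S. ?w ^ card B) < 1 + 1 / real n" .
  moreover have "(\<Sum>B\<in>Pow S. ?w ^ card B) = 1 + (\<Sum>B\<in>Pow S - {{}}. ?w ^ card B)"
    by (subst sum.remove[of _ "{}"]) (use assms in auto)
  ultimately show ?thesis by simp
qed

text \<open>First-moment argument. A placement that fails for some \<open>B\<close> gives that
  \<open>B\<close> a weight \<open>2 ^ (card B - hits)\<close> of at least 1. If every placement
  failed, the total weight would be at least \<open>n ^ m\<close>, but the expected weight of a
  placement is below 1.\<close>

lemma random_placement:
  fixes V :: "'a set" and F :: "'b set set" and R :: "'b set \<Rightarrow> 'a set"
  assumes V: "finite V" "card V = n" "n \<ge> 2"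
    and F: "finite F" "card F \<le> n" "\<And>S. S \<in> F \<Longrightarrow> finite S" "\<And>S. S \<in> F \<Longrightarrow> card S \<le> n"
    and RV: "\<And>B. R B \<subseteq> V"
    and large: "\<And>S B. S \<in> F \<Longrightarrow> B \<subseteq> S \<Longrightarrow> B \<noteq> {} \<Longrightarrow>
      10 * real (card B) * real n * ln (real n) \<le> real m * real (card (R B))"
  shows "\<exists>f. (\<forall>i<m. f i \<in> V) \<and> (\<forall>S\<in>F. \<forall>B\<subseteq>S. card B \<le> card {i. i < m \<and> f i \<in> R B})"
proof (rule ccontr)
  assume none: "\<not> ?thesis"
  define \<Omega> where "\<Omega> = PiE {..<m} (\<lambda>_. V)"
  define c where "c f X = card {i. i < m \<and> f i \<in> X}" for f :: "nat \<Rightarrow> 'a" and X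
  have n: "real n \<ge> 2" using V by simp
  have fin\<Omega>: "finite \<Omega>" unfolding \<Omega>_def using V by (intro finite_PiE) auto
  have card\<Omega>: "card \<Omega> = n ^ m" unfolding \<Omega>_def using V by (subst card_PiE) auto
  have bad: "1 \<le> (\<Sum>S\<in>F. \<Sum>B\<in>Pow S - {{}}. 2 ^ card B * (1 / 2 :: real) ^ c f (R B))"
    if "f \<in> \<Omega>" for f
  proof -
    have "\<forall>i<m. f i \<in> V" using that unfolding \<Omega>_def by auto
    then obtain S B where SB: "S \<in> F" "B \<subseteq> S" "c f (R B) < card B"
      using none unfolding c_def by (meson not_le_imp_less)
    have "B \<noteq> {}" using SB by auto
    have "(1::real) = 2 ^ card B * (1 / 2) ^ card B" by (simp flip: power_mult_distrib)
    also have "\<dots> \<le> 2 ^ card B * (1 / 2) ^ c f (R B)"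
      using SB by (intro mult_left_mono power_decreasing) auto
    also have "\<dots> \<le> (\<Sum>B\<in>Pow S - {{}}. 2 ^ card B * (1 / 2 :: real) ^ c f (R B))"
      by (rule member_le_sum[of B]) (use SB \<open>B \<noteq> {}\<close> F in auto)
    also have "\<dots> \<le> (\<Sum>S\<in>F. \<Sum>B\<in>Pow S - {{}}. 2 ^ card B * (1 / 2 :: real) ^ c f (R B))"
      by (rule member_le_sum[of S "F"]) (use SB F in \<open>auto intro!: sum_nonneg\<close>)
    finally show ?thesis .
  qed
  have pos: "real n ^ m > 0" using n by simp
  have "real n ^ m = (\<Sum>f\<in>\<Omega>. 1)" using card\<Omega> by simp
  also have "\<dots> \<le> (\<Sum>f\<in>\<Omega>. \<Sum>S\<in>F. \<Sum>B\<in>Pow S - {{}}. 2 ^ card B * (1 / 2 :: real) ^ c f (R B))"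
    by (rule sum_mono) (rule bad)
  also have "\<dots> = (\<Sum>S\<in>F. \<Sum>f\<in>\<Omega>. \<Sum>B\<in>Pow S - {{}}. 2 ^ card B * (1 / 2 :: real) ^ c f (R B))"
    by (rule sum.swap)
  also have "\<dots> = (\<Sum>S\<in>F. \<Sum>B\<in>Pow S - {{}}. \<Sum>f\<in>\<Omega>. 2 ^ card B * (1 / 2 :: real) ^ c f (R B))"
    by (rule sum.cong[OF refl], rule sum.swap)
  also have "\<dots> \<le> (\<Sum>S\<in>F. \<Sum>B\<in>Pow S - {{}}. real n ^ m * (1 / real n ^ 4) ^ card B)"
  proof (intro sum_mono)
    fix S B assume SB: "S \<in> F" "B \<in> Pow S - {{}}"
    have "(\<Sum>f\<in>\<Omega>. 2 ^ card B * (1 / 2 :: real) ^ c f (R B))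
      = 2 ^ card B * (real n - real (card (R B)) / 2) ^ m"
      using sum_half_power_hits[OF V(1) RV, of m B] V(2)
      by (simp add: \<Omega>_def c_def sum_distrib_left[symmetric])
    also have "\<dots> \<le> real n ^ m * (1 / real n ^ 4) ^ card B"
      using large[of S B] SB V card_mono[OF V(1) RV[of B]] by (intro hits_weight_bound) auto
    finally show "(\<Sum>f\<in>\<Omega>. 2 ^ card B * (1 / 2 :: real) ^ c f (R B))
      \<le> real n ^ m * (1 / real n ^ 4) ^ card B" .
  qed
  also have "\<dots> = real n ^ m * (\<Sum>S\<in>F. \<Sum>B\<in>Pow S - {{}}. (1 / real n ^ 4) ^ card B)"
    by (simp add: sum_distrib_left)
  finally have ge1: "1 \<le> (\<Sum>S\<in>F. \<Sum>B\<in>Pow S - {{}}. (1 / real n ^ 4) ^ card B)"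
    using pos by simp
  \<comment> \<open>Needed for strictness of the following sum.\<close>
  then have "F \<noteq> {}" by auto
  then have "(\<Sum>S\<in>F. \<Sum>B\<in>Pow S - {{}}. (1 / real n ^ 4) ^ card B) < (\<Sum>S\<in>F. 1 / real n)"
    using F V by (intro sum_strict_mono sum_power_card_nonempty_subsets) auto
  also have "\<dots> \<le> 1" using F(2) n by simp
  finally show False using ge1 by simp
qed

text \<open>Once the robber has chosen \<open>v\<close>, Hall's theorem sends a separate cop into
  each target of \<open>S v\<close>. Since \<open>near\<close> speaks of all vertices of a target,
  it does not matter which one the cop reaches.\<close>

lemma cops_win_of_targets:
  fixes S :: "'a \<Rightarrow> 'a set set"
  assumes V: "finite V" "card V = n" "n \<ge> 2"
    and S: "\<And>v. v \<in> V \<Longrightarrow> finite (S v)" "\<And>v. v \<in> V \<Longrightarrow> card (S v) \<le> n"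
    and large: "\<And>v B. v \<in> V \<Longrightarrow> B \<subseteq> S v \<Longrightarrow> B \<noteq> {} \<Longrightarrow>
      10 * real (card B) * real n * ln (real n) \<le> real m * real (card (NV V E T (\<Union>B)))"
    and near: "\<And>r. robber_play V E r \<Longrightarrow> \<exists>X\<in>S (r 0). \<forall>u\<in>X. move E u (r T)"
  shows "cops_win V E m"
proof -
  have "\<exists>f. (\<forall>i<m. f i \<in> V) \<and>
    (\<forall>S'\<in>S ` V. \<forall>B\<subseteq>S'. card B \<le> card {i. i < m \<and> f i \<in> NV V E T (\<Union>B)})"
  proof (rule random_placement[OF V])
    show "card (S ` V) \<le> n" using V card_image_le by metis
    show "NV V E T (\<Union>B) \<subseteq> V" for B by (auto simp: NV_def)
    fix S' B assume "S' \<in> S ` V" "B \<subseteq> S'" "B \<noteq> {}"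
    then show "10 * real (card B) * real n * ln (real n) \<le> real m * real (card (NV V E T (\<Union>B)))"
      using large by blast
  qed (use V S in auto)
  then obtain f where f_all: "\<forall>i<m. f i \<in> V"
    "\<forall>S'\<in>S ` V. \<forall>B\<subseteq>S'. card B \<le> card {i. i < m \<and> f i \<in> NV V E T (\<Union>B)}"
    by (elim exE conjE)
  have f: "f i \<in> V" if "i < m" for i using f_all(1) that by simp
  have hall_cond: "card B \<le> card {i. i < m \<and> f i \<in> NV V E T (\<Union>B)}"
    if "v \<in> V" "B \<subseteq> S v" for v B
    using f_all(2) that by simp
  have "\<exists>g. inj_on g (S v) \<and> (\<forall>X\<in>S v. g X \<in> {i. i < m \<and> f i \<in> NV V E T X})" if v: "v \<in> V" for v
  proof (rule hall)
    fix B assume B: "B \<subseteq> S v"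
    \<comment> \<open>A cop is near the union of the targets in \<open>B\<close> exactly when it is
      near one of them, so the hits guaranteed by the placement are those counted in Hall's
      condition.\<close>
    have "{i. i < m \<and> f i \<in> NV V E T (\<Union>B)} = (\<Union>X\<in>B. {i. i < m \<and> f i \<in> NV V E T X})"
      by (auto simp: NV_iff)
    then show "card B \<le> card (\<Union>X\<in>B. {i. i < m \<and> f i \<in> NV V E T X})"
      using hall_cond[OF v B] by simp
  qed (use S v in auto)
  then have "\<forall>v\<in>V. \<exists>g. inj_on g (S v) \<and> (\<forall>X\<in>S v. g X \<in> {i. i < m \<and> f i \<in> NV V E T X})"
    by blast
  from bchoice[OF this] obtain g where g_all: "\<forall>v\<in>V. inj_on (g v) (S v) \<and>
      (\<forall>X\<in>S v. g v X \<in> {i. i < m \<and> f i \<in> NV V E T X})" ..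
  have g: "inj_on (g v) (S v)" "\<And>X. X \<in> S v \<Longrightarrow> g v X < m \<and> f (g v X) \<in> NV V E T X"
    if "v \<in> V" for v
    using g_all that by auto
  define path where "path v i p \<longleftrightarrow> p 0 = f i \<and> (\<forall>t<T. move E (p t) (p (Suc t))) \<and>
      (\<forall>X\<in>S v. i = g v X \<longrightarrow> p T \<in> X)" for v i p
  have ex_path: "\<exists>p. path v i p" if v: "v \<in> V" for v i
  proof (cases "\<exists>X\<in>S v. i = g v X")
    case True
    then obtain X where X: "X \<in> S v" "i = g v X" by blast
    then obtain u where u: "u \<in> X" "(move E ^^ T) u (f i)" using g(2)[OF v X(1)] by (auto simp: NV_iff)
    obtain p where p: "p 0 = f i" "p T = u" "\<forall>t<T. move E (p t) (p (Suc t))"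
      using relpowp_move_sym[OF u(2)] unfolding relpowp_fun_conv by blast
    \<comment> \<open>By injectivity cop \<open>i\<close> has only one target, so a single path
      serves it. Cops without a target stay where they are.\<close>
    have "X' = X" if "X' \<in> S v" "i = g v X'" for X'
      using g(1)[OF v] X that by (metis inj_onD)
    then have "path v i p" unfolding path_def using p u by blast
    then show ?thesis by blast
  next
    case False
    then have "path v i (\<lambda>_. f i)" unfolding path_def by (auto simp: move_refl)
    then show ?thesis by blast
  qed
  define P where "P v i = (SOME p. path v i p)" for v i
  have "path v i (P v i)" if "v \<in> V" for v i
    unfolding P_def using ex_path[OF that] by (rule someI_ex)
  then have P: "P v i 0 = f i" "t < T \<Longrightarrow> move E (P v i t) (P v i (Suc t))"
    "X \<in> S v \<Longrightarrow> P v (g v X) T \<in> X" if "v \<in> V" for v i t X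
    using that unfolding path_def by blast+
  show ?thesis
  proof (rule cops_win_paths[of m f V P T])
    fix r assume r: "robber_play V E r"
    then have v: "r 0 \<in> V" by (simp add: robber_play_def)
    obtain X where X: "X \<in> S (r 0)" "\<forall>u\<in>X. move E u (r T)" using near[OF r] by blast
    then show "\<exists>i<m. move E (P (r 0) i T) (r T)"
      using P(3)[OF v X(1)] g(2)[OF v X(1)] by blast
  qed (use f P in auto)
qed

section \<open>The bound on the cop number\<close>

lemma half_le_ln:
  fixes n :: nat
  assumes "n \<ge> 2"
  shows "1 / 2 \<le> ln (real n)"
proof -
  have "ln 2 \<ge> (1 / 2 :: real)" using exp_half_le2 by (subst ln_ge_iff) auto
  moreover have "ln 2 \<le> ln (real n)" using assms by simp
  ultimately show ?thesis by linarith
qed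

text \<open>Common arithmetic of both cases: \<open>y\<close> is the growth per target, and
  \<open>q * y\<close> reaches \<open>n\<close>. One factor \<open>1 / \<xi>\<close> pays for the
  number of targets, the other for the loss in expansion.\<close>

lemma cop_number_le_of_targets:
  fixes S :: "'a \<Rightarrow> 'a set set" and \<xi> q y :: real
  assumes V: "finite V" "card V = n" "n \<ge> 2"
    and \<xi>: "0 < \<xi>" "\<xi> \<le> 1" and q: "1 \<le> q" "real n \<le> q * y"
    and small: "20 / \<xi>\<^sup>2 * q * ln (real n) < real n"
    and S: "\<And>v. v \<in> V \<Longrightarrow> finite (S v)" "\<And>v. v \<in> V \<Longrightarrow> real (card (S v)) \<le> q / \<xi>"
    and expand: "\<And>v B. v \<in> V \<Longrightarrow> B \<subseteq> S v \<Longrightarrow>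
      \<xi> * min (real (card B) * y) (real n) \<le> real (card (NV V E T (\<Union>B)))"
    and near: "\<And>r. robber_play V E r \<Longrightarrow> \<exists>X\<in>S (r 0). \<forall>u\<in>X. move E u (r T)"
  shows "real (cop_number V E) \<le> 20 / \<xi>\<^sup>2 * q * ln (real n)"
proof -
  define L where "L = ln (real n)"
  define b where "b = 20 / \<xi>\<^sup>2 * q * L"
  define m where "m = nat \<lfloor>b\<rfloor>"
  have L: "L \<ge> 1 / 2" unfolding L_def using V(3) by (rule half_le_ln)
  have inv: "1 / \<xi> \<ge> 1" using \<xi> by simp
  have q\<xi>: "q / \<xi> \<ge> 1" using mult_mono[OF q(1) inv] q by simp
  have b_eq: "b = 20 * L * (1 / \<xi>) * (q / \<xi>)" unfolding b_def by (simp add: power2_eq_square)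
  have "10 * 1 \<le> 20 * L * (1 / \<xi>)" by (intro mult_mono) (use L inv in auto)
  then have b_ge: "10 * (q / \<xi>) \<le> b"
    unfolding b_eq using q\<xi> by (intro mult_right_mono) auto
  \<comment> \<open>As \<open>b\<close> is at least 10, rounding down loses less than half; this is
    why 20 in the bound yields the 10 required of \<open>m\<close>.\<close>
  have m: "real m \<le> b" "b / 2 \<le> real m" unfolding m_def using b_ge q\<xi> by linarith+
  have "b < real n" using small unfolding b_def L_def .
  then have S_le: "card (S v) \<le> n" if "v \<in> V" for v
    using S(2)[OF that] b_ge q\<xi> by linarith
  have "cops_win V E m"
  proof (rule cops_win_of_targets[of V n S m E T])
    fix v B assume v: "v \<in> V" and B: "B \<subseteq> S v"
    let ?c = "real (card B)" and ?mu = "min (real (card B) * y) (real n)"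
    have c: "?c \<le> q / \<xi>"
      using S[OF v] card_mono[OF S(1)[OF v] B] by linarith
    \<comment> \<open>Before saturation this uses \<open>n \<le> q * y\<close>; after it, the bound
      on the number of targets.\<close>
    have "?c * real n \<le> (q / \<xi>) * ?mu"
    proof (cases "?c * y \<le> real n")
      case True
      have "?c * real n \<le> ?c * (q * y)" using q by (intro mult_left_mono) auto
      also have "\<dots> = 1 * (q * (?c * y))" by simp
      also have "\<dots> \<le> (1 / \<xi>) * (q * (?c * y))"
      proof (intro mult_right_mono inv)
        have "0 \<le> q * y" using q(2) by linarith
        then show "0 \<le> q * (?c * y)" using q(1) by (simp add: zero_le_mult_iff)
      qed
      finally show ?thesis using True by simp
    next
      case False
      then show ?thesis using mult_right_mono[OF c, of "real n"] by simp
    qed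
    then have "(10 * L) * (?c * real n) \<le> (10 * L) * ((q / \<xi>) * ?mu)"
      using L by (intro mult_left_mono) auto
    also have "\<dots> = (b / 2) * (\<xi> * ?mu)"
      unfolding b_eq using \<xi> by simp
    also have "\<dots> \<le> (b / 2) * real (card (NV V E T (\<Union>B)))"
      using expand[OF v B] b_ge q\<xi> by (intro mult_left_mono) auto
    also have "\<dots> \<le> real m * real (card (NV V E T (\<Union>B)))"
      using m by (intro mult_right_mono) auto
    finally show "10 * ?c * real n * ln (real n) \<le> real m * real (card (NV V E T (\<Union>B)))"
      unfolding L_def by (simp add: mult_ac)
  qed (use V S(1) S_le near in auto)
  then have "cop_number V E \<le> m" unfolding cop_number_def by (rule Least_le)
  then show ?thesis using m unfolding b_def L_def by linarith
qed

lemma exists_power_interval: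
  fixes d s :: real
  assumes "1 < d" "1 \<le> s"
  shows "\<exists>r. d ^ r \<le> s \<and> s < d ^ Suc r"
proof -
  have ex: "\<exists>j. s < d ^ j" using real_arch_pow[OF assms(1)] by blast
  define j where "j = (LEAST j. s < d ^ j)"
  have j: "s < d ^ j" unfolding j_def by (rule LeastI_ex[OF ex])
  then have "j \<noteq> 0" using assms by (intro notI) simp
  then obtain r where r: "j = Suc r" using not0_implies_Suc by blast
  then have "\<not> s < d ^ r" using not_less_Least[of r "\<lambda>j. s < d ^ j"] by (simp add: j_def)
  then show ?thesis using j r by force
qed

text \<open>Every ball around an isolated vertex is a singleton, while expansion at a large radius
  demands \<open>\<xi> * n\<close> vertices. This serves the edge targets, where a resting robber
  must still lie on some edge.\<close>

lemma expanding_isolated_vertex: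
  assumes exp: "expanding k \<xi> V E" and k: "k \<ge> 2" and v: "v \<in> V" "\<And>e. e \<in> E \<Longrightarrow> v \<notin> e"
  shows "\<xi> * real (card V) \<le> 1"
proof -
  have d: "1 < avg_degree V E" using exp k by (auto simp: expanding_def Let_def)
  obtain r where r: "real (card V) < avg_degree V E ^ r" using real_arch_pow[OF d] by blast
  \<comment> \<open>The exponent is raised because expansion is assumed only for radii from 1
    on.\<close>
  also have "\<dots> \<le> avg_degree V E ^ Suc r" using d by simp
  finally have r': "real (card V) < avg_degree V E ^ Suc r" .
  have "(move E ^^ s) v w \<Longrightarrow> w = v" for s w
  proof (induction s arbitrary: w)
    case (Suc s)
    then have "move E v w" by auto
    then show ?case using v(2) by (auto simp: move_def)
  qed simp
  then have "NV V E (Suc r) {v} \<subseteq> {v}" by (auto simp: NV_iff simp del: relpowp.simps)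
  then have "card (NV V E (Suc r) {v}) \<le> 1" using card_mono[of "{v}"] by simp
  moreover have "\<xi> * min (real (card {v}) * avg_degree V E ^ Suc r) (real (card V))
      \<le> real (card (NV V E (Suc r) {v}))"
  proof -
    have "{v} \<subseteq> V" "1 \<le> Suc r" using v(1) by auto
    then show ?thesis using exp unfolding expanding_def Let_def by blast
  qed
  ultimately show ?thesis using r' by simp
qed

lemma avg_degree_le_card:
  assumes "finite V"
  shows "avg_degree V E \<le> real (card V)"
proof -
  have "card (NV V E 1 {v}) \<le> card V" for v
    using assms by (intro card_mono) (auto simp: NV_def)
  then have "(\<Sum>v\<in>V. real (card (NV V E 1 {v}))) \<le> real (card V) * real (card V)"
    using sum_bounded_above[of V "\<lambda>v. real (card (NV V E 1 {v}))" "real (card V)"] by simp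
  then show ?thesis
    by (cases "card V = 0") (auto simp: avg_degree_def field_simps)
qed

theorem theorem1p5:
  fixes V :: "'a set" and E :: "'a set set" and k n :: nat and \<xi> :: real
  assumes "k \<ge> 2" and "\<xi> > 0"
    and "k_graph k V E" and "card V = n"
    and "expanding k \<xi> V E"
  shows "real (cop_number V E) \<le> 20 / \<xi>\<^sup>2 * sqrt (real n / real k) * ln (real n)"
proof (cases "real n \<le> 20 / \<xi>\<^sup>2 * sqrt (real n / real k) * ln (real n)")
  \<comment> \<open>If the bound is at least \<open>n\<close>, one cop per vertex suffices.\<close>
  case True
  have "cop_number V E \<le> card V"
    unfolding cop_number_def using assms(3) by (intro Least_le cops_win_card) (auto simp: k_graph_def)
  then show ?thesis using True assms(4) by linarith
next
  case False
  define d where "d = avg_degree V E"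
  define q where "q = sqrt (real n / real k)"
  define s where "s = sqrt (real n * real k)"
  have V: "finite V" and E: "\<And>e. e \<in> E \<Longrightarrow> e \<subseteq> V"
    using assms(3) by (auto simp: k_graph_def)
  have dk: "real k \<le> d" and \<xi>: "0 < \<xi>" "\<xi> \<le> 1"
    and A1: "\<And>v r. v \<in> V \<Longrightarrow> 1 \<le> r \<Longrightarrow> d ^ r \<le> s \<Longrightarrow>
      real (card (NE E r {v})) \<le> (1 / \<xi>) * (d ^ r / real k)"
    and A2: "\<And>A r. A \<subseteq> V \<Longrightarrow> 1 \<le> r \<Longrightarrow>
      \<xi> * min (real (card A) * d ^ r) (real n) \<le> real (card (NV V E r A)) \<and>
      real (card (NV V E r A)) \<le> (1 / \<xi>) * (real (card A) * d ^ r)"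
    and A3: "\<And>B r. B \<subseteq> E \<Longrightarrow> 1 \<le> r \<Longrightarrow>
      \<xi> * min (real (card B) * real k * d ^ r) (real n) \<le> real (card (NV V E r (\<Union>B)))"
    using assms(4,5) unfolding expanding_def Let_def d_def s_def by auto
  have kn: "real k \<le> real n"
    using dk avg_degree_le_card[OF V, of E] assms(4) unfolding d_def by linarith
  have n: "n \<ge> 2" and k0: "real k > 0" and d: "d > 1" using kn dk assms(1) by auto
  have q1: "1 \<le> q" unfolding q_def using kn k0 by simp
  have qs: "q * s = real n" unfolding q_def s_def using k0 by (simp flip: real_sqrt_mult)
  have sk: "s / real k = q" and qk: "q * real k = s"
  proof -
    have "sqrt (real k) * sqrt (real k) = real k" by simp
    then show "q * real k = s"
      unfolding q_def s_def using k0 by (simp add: real_sqrt_divide real_sqrt_mult field_simps)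
    then show "s / real k = q" using k0 by (simp add: field_simps)
  qed
  have "q * 1 \<le> q * real k" using q1 assms(1) by (intro mult_left_mono) auto
  then have "1 \<le> s" using q1 qk by simp
  then obtain r where r: "d ^ r \<le> s" "s < d ^ Suc r" using exists_power_interval[OF d] by blast
  note bound = cop_number_le_of_targets[OF V assms(4) n \<xi> q1]
  have small: "20 / \<xi>\<^sup>2 * q * ln (real n) < real n" using False unfolding q_def by simp
  have "real (cop_number V E) \<le> 20 / \<xi>\<^sup>2 * q * ln (real n)"
  proof (cases "d ^ r \<le> q")
    case rq: True
    \<comment> \<open>Vertex targets, as singletons: there are at most
      \<open>d ^ r / \<xi> \<le> q / \<xi>\<close> of them, and \<open>T = r + 1\<close> gives
      growth \<open>d ^ Suc r > s = n / q\<close>.\<close>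
    let ?S = "\<lambda>v. (\<lambda>u. {u}) ` NV V E r {v}"
    show ?thesis
    proof (rule bound[of "d ^ Suc r" ?S E "Suc r"])
      show "real n \<le> q * d ^ Suc r"
        using r(2) q1 unfolding qs[symmetric] by (intro mult_left_mono) auto
      show "finite (?S v)" for v using V by (auto simp: NV_def)
      show "real (card (?S v)) \<le> q / \<xi>" if v: "v \<in> V" for v
      proof -
        have "real (card (NV V E r {v})) \<le> d ^ r / \<xi>"
        proof (cases r)
          \<comment> \<open>Radius 0 is not covered by \<open>A2\<close>; the ball is then the
            single vertex \<open>v\<close>.\<close>
          case 0
          then have "NV V E r {v} = {v}" using v by (auto simp: NV_iff)
          then show ?thesis using 0 \<xi> by simp
        next
          case (Suc r')
          then show ?thesis using A2[of "{v}" r] v by simp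
        qed
        also have "\<dots> \<le> q / \<xi>" using rq \<xi> by (simp add: divide_right_mono)
        finally show ?thesis by (simp add: card_image)
      qed
    next
      fix v B assume B: "B \<subseteq> ?S v"
      then have "B = (\<lambda>u. {u}) ` \<Union>B" by fastforce
      then have "card B = card (\<Union>B)" by (metis card_image inj_singleton inj_on_subset subset_UNIV)
      moreover have "\<Union>B \<subseteq> V" using B by (auto simp: NV_def)
      ultimately show "\<xi> * min (real (card B) * d ^ Suc r) (real n)
          \<le> real (card (NV V E (Suc r) (\<Union>B)))"
        using A2[of "\<Union>B" "Suc r"] by simp
    next
      fix p assume p: "robber_play V E p"
      \<comment> \<open>The cop sent to \<open>p r\<close> arrives while the robber is there;
        adjacency to \<open>p (Suc r)\<close> is recorded only to fit the common form of
        \<open>near\<close>.\<close>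
      then have "p r \<in> NV V E r {p 0}"
        using robber_play_walk[OF p] robber_play_in[OF p E] by (simp add: NV_iff)
      moreover have "move E (p r) (p (Suc r))" using p by (simp add: robber_play_def)
      ultimately show "\<exists>X\<in>?S (p 0). \<forall>u\<in>X. move E u (p (Suc r))" by auto
    qed (rule small)
  next
    case rq: False
    \<comment> \<open>Edge targets: \<open>A1\<close> allows at most \<open>s / k = q\<close> of
      them up to the factor \<open>1 / \<xi>\<close>, and \<open>A3\<close> gives growth
      \<open>k * d ^ r > k * q = s\<close>. Radius 0 is excluded because
      \<open>d ^ 0 = 1 \<le> q\<close>.\<close>
    then have r1: "1 \<le> r" using q1 by (cases r) auto
    show ?thesis
    proof (rule bound[of "real k * d ^ r" "\<lambda>v. NE E r {v}" E r])
      have "s \<le> real k * d ^ r" using rq k0 unfolding qk[symmetric] by (simp add: mult.commute)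
      then show "real n \<le> q * (real k * d ^ r)"
        using q1 unfolding qs[symmetric] by (intro mult_left_mono) auto
      have "finite E" using V E by (meson PowI finite_Pow_iff finite_subset subsetI)
      then show "finite (NE E r {v})" for v by (auto simp: NE_def)
      show "real (card (NE E r {v})) \<le> q / \<xi>" if "v \<in> V" for v
      proof -
        have "real (card (NE E r {v})) \<le> (1 / \<xi>) * (d ^ r / real k)" using A1[OF that r1 r(1)] .
        also have "\<dots> \<le> (1 / \<xi>) * (s / real k)"
          using \<xi> r(1) k0 by (intro mult_left_mono divide_right_mono) auto
        finally show ?thesis unfolding sk by simp
      qed
    next
      fix v B assume "B \<subseteq> NE E r {v}"
      then have "B \<subseteq> E" by (auto simp: NE_def)
      then show "\<xi> * min (real (card B) * (real k * d ^ r)) (real n)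
          \<le> real (card (NV V E r (\<Union>B)))"
        using A3[of B r] r1 by (simp add: mult.assoc)
    next
      fix p assume p: "robber_play V E p"
      obtain j where j: "r = Suc j" using r1 by (cases r) auto
      have mv: "move E (p j) (p r)" using p j by (simp add: robber_play_def)
      \<comment> \<open>A proper move uses an edge. A resting robber needs any edge at his vertex;
        an isolated vertex would force \<open>n \<le> 1 / \<xi>\<close>, contradicting
        \<open>small\<close>.\<close>
      have "\<exists>e\<in>E. p j \<in> e \<and> p r \<in> e"
      proof (rule ccontr)
        assume no: "\<not> ?thesis"
        then have "p j = p r" using mv unfolding move_def by blast
        then have isolated: "p j \<notin> e" if "e \<in> E" for e using no that by metis
        have "p j \<in> V" using robber_play_in[OF p E] .
        then have "\<xi> * real n \<le> 1"
          using expanding_isolated_vertex[OF assms(5,1) _ isolated] assms(4) by simp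
        then have "real n \<le> 1 / \<xi>" using \<xi> by (simp add: field_simps)
        also have "\<dots> \<le> 20 / \<xi>\<^sup>2 * q * ln (real n)"
        proof -
          have "1 * 1 * 1 \<le> (1 / \<xi>) * q * (20 * ln (real n))"
            using \<xi> q1 half_le_ln[OF n] by (intro mult_mono) auto
          then have "1 / \<xi> * 1 \<le> 1 / \<xi> * ((1 / \<xi>) * q * (20 * ln (real n)))"
            using \<xi> by (intro mult_left_mono) auto
          then show ?thesis by (simp add: power2_eq_square mult_ac)
        qed
        finally show False using small by simp
      qed
      then obtain e where e: "e \<in> E" "p j \<in> e" "p r \<in> e" by blast
      have "e \<in> NE E r {p 0}"
        using e j relpowp_move_sym[OF robber_play_walk[OF p, of j]] by (auto simp: NE_iff)
      then show "\<exists>X\<in>NE E r {p 0}. \<forall>u\<in>X. move E u (p r)"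
        using e by (auto simp: move_def)
    qed (rule small)
  qed
  then show ?thesis unfolding q_def .
qed

end
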